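(* Let $G$ be an Abelian group and $S$ a subsemigroup of $G$ with $0\in S$. The following conditions are equivalent: (1) the space $G_S$ is feebly compact; (2) the space $G_S$ is countably pracompact; (3) the space $G_S$ is sequentially pracompact; (4) the subgroup $S-S$ has finite index in $G$.
   Context: For an Abelian group $G$ (written additively) and a subsemigroup $S\ni 0$ of $G$, $G_S$ denotes the group $G$ endowed with the topology consisting of all sets $A+S$ with $A\subseteq G$ (equivalently, all $U\subseteq G$ with $u+S\subseteq U$ for each $u\in U$). Here $S-S=\{s-t: s,t\in S\}$. A space $X$ is feebly compact if each locally finite family of open subsets of $X$ is finite; countably pracompact if there is a dense set $D\subseteq X$ such that each infinite $B\subseteq D$ has an accumulation point $x\in X$ (each neighborhood of $x$ contains infinitely many points of $B$); sequentially pracompact if there is a dense set $D\subseteq X$ such that each sequence of points of $D$ has a subsequence convergent in $X$. No separation axioms are assumed. *)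

theory Defs
  imports "HOL-Analysis.Abstract_Limits" "HOL-Algebra.Coset"
begin

definition feebly_compact :: "'a topology \<Rightarrow> bool" where
  "feebly_compact X \<longleftrightarrow>
     (\<forall>\<U>. (\<forall>U\<in>\<U>. openin X U) \<and> locally_finite_in X \<U> \<longrightarrow> finite \<U>)"

definition dense_subset :: "'a topology \<Rightarrow> 'a set \<Rightarrow> bool" where
  "dense_subset X D \<longleftrightarrow> D \<subseteq> topspace X \<and> X closure_of D = topspace X"

(* Without T1 separation this is stronger than membership in the derived set. *)
definition accumulation_point :: "'a topology \<Rightarrow> 'a set \<Rightarrow> 'a \<Rightarrow> bool" where
  "accumulation_point X B x \<longleftrightarrow>
     x \<in> topspace X \<and> (\<forall>U. openin X U \<and> x \<in> U \<longrightarrow> infinite (U \<inter> B))"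

definition countably_pracompact :: "'a topology \<Rightarrow> bool" where
  "countably_pracompact X \<longleftrightarrow>
     (\<exists>D. dense_subset X D \<and>
        (\<forall>B. B \<subseteq> D \<and> infinite B \<longrightarrow> (\<exists>x. accumulation_point X B x)))"

definition sequentially_pracompact :: "'a topology \<Rightarrow> bool" where
  "sequentially_pracompact X \<longleftrightarrow>
     (\<exists>D. dense_subset X D \<and>
        (\<forall>\<sigma> :: nat \<Rightarrow> 'a. range \<sigma> \<subseteq> D \<longrightarrow>
           (\<exists>r x. strict_mono r \<and> limitin X (\<sigma> \<circ> r) x sequentially)))"

(* The space G_S. The group operation is written multiplicatively, as in HOL-Algebra,
   so A <#> S is the set A + S. The lemmas below show that for a submonoid S these
   sets do form a topology on carrier G. *)
definition semigroup_topology :: "('a, 'b) monoid_scheme \<Rightarrow> 'a set \<Rightarrow> 'a topology" where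
  "semigroup_topology G S = topology (\<lambda>U. \<exists>A\<subseteq>carrier G. U = A <#>\<^bsub>G\<^esub> S)"

(* The set S - S. *)
definition difference_set :: "('a, 'b) monoid_scheme \<Rightarrow> 'a set \<Rightarrow> 'a set" where
  "difference_set G S = {s \<otimes>\<^bsub>G\<^esub> inv\<^bsub>G\<^esub> t | s t. s \<in> S \<and> t \<in> S}"

definition has_finite_index :: "('a, 'b) monoid_scheme \<Rightarrow> 'a set \<Rightarrow> bool" where
  "has_finite_index G H \<longleftrightarrow> subgroup H G \<and> finite (rcosets\<^bsub>G\<^esub> H)"

lemma set_mult_submonoid_iff:
  assumes "comm_group G" "submonoid S G"
  shows "(\<exists>A\<subseteq>carrier G. U = A <#>\<^bsub>G\<^esub> S) \<longleftrightarrow>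
         U \<subseteq> carrier G \<and> (\<forall>u\<in>U. u <#\<^bsub>G\<^esub> S \<subseteq> U)"
proof -
  interpret comm_group G by fact
  interpret S: submonoid S G by fact
  show ?thesis
  proof
    assume "\<exists>A\<subseteq>carrier G. U = A <#>\<^bsub>G\<^esub> S"
    then obtain A where A: "A \<subseteq> carrier G" "U = A <#>\<^bsub>G\<^esub> S" by blast
    have "a \<otimes>\<^bsub>G\<^esub> s \<otimes>\<^bsub>G\<^esub> t \<in> U" if "a \<in> A" "s \<in> S" "t \<in> S" for a s t
    proof -
      have "a \<otimes>\<^bsub>G\<^esub> s \<otimes>\<^bsub>G\<^esub> t = a \<otimes>\<^bsub>G\<^esub> (s \<otimes>\<^bsub>G\<^esub> t)"
        using that A(1) S.subset by (intro m_assoc) auto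
      with that show ?thesis
        unfolding A(2) set_mult_def by auto
    qed
    then have "\<forall>u\<in>U. u <#\<^bsub>G\<^esub> S \<subseteq> U"
      unfolding l_coset_def using A(2) by (auto simp: set_mult_def)
    moreover have "U \<subseteq> carrier G"
      using A S.subset by (simp add: set_mult_closed)
    ultimately show "U \<subseteq> carrier G \<and> (\<forall>u\<in>U. u <#\<^bsub>G\<^esub> S \<subseteq> U)" by blast
  next
    assume U: "U \<subseteq> carrier G \<and> (\<forall>u\<in>U. u <#\<^bsub>G\<^esub> S \<subseteq> U)"
    have "U \<subseteq> U <#>\<^bsub>G\<^esub> S"
    proof
      fix u assume "u \<in> U"
      then have "u = u \<otimes>\<^bsub>G\<^esub> \<one>\<^bsub>G\<^esub>" using U by auto
      with \<open>u \<in> U\<close> show "u \<in> U <#>\<^bsub>G\<^esub> S"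
        unfolding set_mult_def using S.one_closed by blast
    qed
    moreover have "U <#>\<^bsub>G\<^esub> S \<subseteq> U"
      using U unfolding set_mult_def l_coset_def by blast
    ultimately show "\<exists>A\<subseteq>carrier G. U = A <#>\<^bsub>G\<^esub> S" using U by blast
  qed
qed

lemma openin_semigroup_topology:
  assumes "comm_group G" "submonoid S G"
  shows "openin (semigroup_topology G S) U \<longleftrightarrow> (\<exists>A\<subseteq>carrier G. U = A <#>\<^bsub>G\<^esub> S)"
proof -
  have "istopology (\<lambda>U. \<exists>A\<subseteq>carrier G. U = A <#>\<^bsub>G\<^esub> S)"
    unfolding set_mult_submonoid_iff[OF assms] istopology_def by blast
  then show ?thesis
    unfolding semigroup_topology_def by (simp add: topology_inverse')
qed

lemma openin_semigroup_topology_iff: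
  assumes "comm_group G" "submonoid S G"
  shows "openin (semigroup_topology G S) U \<longleftrightarrow>
         U \<subseteq> carrier G \<and> (\<forall>u\<in>U. u <#\<^bsub>G\<^esub> S \<subseteq> U)"
  using openin_semigroup_topology[OF assms] set_mult_submonoid_iff[OF assms] by simp

lemma topspace_semigroup_topology:
  assumes "comm_group G" "submonoid S G"
  shows "topspace (semigroup_topology G S) = carrier G"
proof -
  interpret comm_group G by fact
  interpret S: submonoid S G by fact
  have "openin (semigroup_topology G S) (carrier G)"
    unfolding openin_semigroup_topology_iff[OF assms]
    using S.subset by (auto simp: l_coset_def)
  then show ?thesis
    using openin_semigroup_topology_iff[OF assms]
    by (metis openin_subset openin_topspace subset_antisym)
qed

lemma subgroup_difference_set:
  assumes "comm_group G" "submonoid S G"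
  shows "subgroup (difference_set G S) G"
proof -
  interpret comm_group G by fact
  interpret S: submonoid S G by fact
  have S: "x \<in> carrier G" if "x \<in> S" for x
    using that S.subset by blast
  show ?thesis
  proof
    show "difference_set G S \<subseteq> carrier G"
      unfolding difference_set_def using S by auto
    have "\<one>\<^bsub>G\<^esub> = \<one>\<^bsub>G\<^esub> \<otimes>\<^bsub>G\<^esub> inv\<^bsub>G\<^esub> \<one>\<^bsub>G\<^esub>" by simp
    then show "\<one>\<^bsub>G\<^esub> \<in> difference_set G S"
      unfolding difference_set_def using S.one_closed by blast
  next
    fix x y assume "x \<in> difference_set G S" "y \<in> difference_set G S"
    then obtain s t u v where st: "s \<in> S" "t \<in> S" "u \<in> S" "v \<in> S"
      "x = s \<otimes>\<^bsub>G\<^esub> inv\<^bsub>G\<^esub> t" "y = u \<otimes>\<^bsub>G\<^esub> inv\<^bsub>G\<^esub> v"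
      unfolding difference_set_def by blast
    then have "x \<otimes>\<^bsub>G\<^esub> y = (s \<otimes>\<^bsub>G\<^esub> u) \<otimes>\<^bsub>G\<^esub> inv\<^bsub>G\<^esub> (t \<otimes>\<^bsub>G\<^esub> v)"
      using S by (simp add: inv_mult m_ac)
    with st show "x \<otimes>\<^bsub>G\<^esub> y \<in> difference_set G S"
      unfolding difference_set_def using S.m_closed by blast
  next
    fix x assume "x \<in> difference_set G S"
    then obtain s t where st: "s \<in> S" "t \<in> S" "x = s \<otimes>\<^bsub>G\<^esub> inv\<^bsub>G\<^esub> t"
      unfolding difference_set_def by blast
    then have "inv\<^bsub>G\<^esub> x = t \<otimes>\<^bsub>G\<^esub> inv\<^bsub>G\<^esub> s"
      using S by (simp add: inv_mult m_ac)
    with st show "inv\<^bsub>G\<^esub> x \<in> difference_set G S"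
      unfolding difference_set_def by blast
  qed
qed

end

theory Submission
  imports Defs
begin

text \<open>
  Put \<open>H = S - S\<close>. The cosets of \<open>H\<close> partition \<open>G\<^sub>S\<close> into open sets, and each of the three
  compactness properties rules out an infinite open partition. Conversely, \<open>x + S\<close> is the
  least neighbourhood of \<open>x\<close>, and \<open>u + S\<close> meets \<open>x + S\<close> whenever \<open>u \<in> x + H\<close>. Hence, if \<open>F\<close>
  represents all cosets, \<open>F + S\<close> is dense, and whatever happens infinitely often in \<open>F + S\<close>
  with \<open>F\<close> finite happens infinitely often in a single \<open>x + S\<close>, thus in every neighbourhood
  of \<open>x\<close>.
\<close>

section \<open>Open partitions of spaces with compactness properties\<close>

lemma dense_subset_meets_open:
  assumes "dense_subset X D" "openin X U" "U \<noteq> {}"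
  shows "U \<inter> D \<noteq> {}"
  using assms unfolding dense_subset_def dense_intersects_open by (metis Int_commute)

lemma pairwise_disjnt_eqI:
  assumes "pairwise disjnt \<C>" "C \<in> \<C>" "E \<in> \<C>" "x \<in> C" "x \<in> E"
  shows "C = E"
  using pairwiseD[OF assms(1-3)] assms(4,5) by (auto simp: disjnt_iff)

text \<open>A partition into open sets is locally finite: the member containing a point is a
  neighbourhood of it that meets no other member.\<close>

lemma feebly_compact_finite_open_partition:
  assumes fc: "feebly_compact X"
    and op: "\<And>C. C \<in> \<C> \<Longrightarrow> openin X C"
    and disj: "pairwise disjnt \<C>"
    and cover: "\<Union>\<C> = topspace X"
  shows "finite \<C>"
proof -
  have "\<exists>V. openin X V \<and> x \<in> V \<and> finite {U \<in> \<C>. U \<inter> V \<noteq> {}}" if x: "x \<in> topspace X" for x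
  proof -
    obtain C where C: "C \<in> \<C>" "x \<in> C" using x cover by blast
    have "{U \<in> \<C>. U \<inter> C \<noteq> {}} \<subseteq> {C}"
    proof
      fix U assume "U \<in> {U \<in> \<C>. U \<inter> C \<noteq> {}}"
      then obtain y where "U \<in> \<C>" "y \<in> U" "y \<in> C" by blast
      then show "U \<in> {C}" using pairwise_disjnt_eqI[OF disj _ C(1)] by simp
    qed
    then have "finite {U \<in> \<C>. U \<inter> C \<noteq> {}}" by (rule finite_subset) simp
    then show ?thesis using op C by blast
  qed
  then have "locally_finite_in X \<C>"
    unfolding locally_finite_in_def using cover by simp
  then show ?thesis using fc op unfolding feebly_compact_def by simp
qed

text \<open>Density gives a point of \<open>D\<close> in each member, and disjointness keeps the
  chosen points distinct. They serve below as the infinite subset or the sequence on which countable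
  or sequential pracompactness is tested.\<close>

lemma open_partition_selection:
  assumes dense: "dense_subset X D"
    and op: "\<And>C. C \<in> \<C> \<Longrightarrow> openin X C" and ne: "{} \<notin> \<C>"
    and disj: "pairwise disjnt \<C>"
  shows "\<exists>p. (\<forall>C\<in>\<C>. p C \<in> C \<inter> D) \<and> inj_on p \<C>"
proof -
  have "\<forall>C\<in>\<C>. \<exists>y. y \<in> C \<inter> D"
    using dense_subset_meets_open[OF dense] op ne by blast
  then obtain p where p: "\<And>C. C \<in> \<C> \<Longrightarrow> p C \<in> C \<inter> D"
    by metis
  have "inj_on p \<C>"
  proof (rule inj_onI)
    fix C E assume "C \<in> \<C>" "E \<in> \<C>" "p C = p E"
    then show "C = E" using p[of C] p[of E] pairwise_disjnt_eqI[OF disj, of C E "p C"] by simp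
  qed
  with p show ?thesis by (intro exI[of _ p]) simp
qed

text \<open>An infinite partition would yield an infinite set of selected points. An accumulation
  point of it lies in some member, but this open neighbourhood contains only one selected
  point.\<close>

lemma countably_pracompact_finite_open_partition:
  assumes cp: "countably_pracompact X"
    and op: "\<And>C. C \<in> \<C> \<Longrightarrow> openin X C" and ne: "{} \<notin> \<C>"
    and disj: "pairwise disjnt \<C>"
    and cover: "\<Union>\<C> = topspace X"
  shows "finite \<C>"
proof (rule ccontr)
  assume inf: "infinite \<C>"
  obtain D where D: "dense_subset X D"
    and acc: "\<And>B. B \<subseteq> D \<Longrightarrow> infinite B \<Longrightarrow> \<exists>x. accumulation_point X B x"
    using cp unfolding countably_pracompact_def by blast
  obtain p where p: "\<And>C. C \<in> \<C> \<Longrightarrow> p C \<in> C \<inter> D" and inj: "inj_on p \<C>"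
    using open_partition_selection[OF D _ ne disj] op by blast
  have "infinite (p ` \<C>)" using inf inj finite_image_iff by blast
  then obtain x where x: "accumulation_point X (p ` \<C>) x"
    using acc[of "p ` \<C>"] p by blast
  then obtain C where C: "C \<in> \<C>" "x \<in> C"
    using cover unfolding accumulation_point_def by blast
  then have "infinite (C \<inter> p ` \<C>)"
    using x op unfolding accumulation_point_def by blast
  moreover have "C \<inter> p ` \<C> \<subseteq> {p C}"
  proof
    fix y assume "y \<in> C \<inter> p ` \<C>"
    then obtain E where "E \<in> \<C>" "y = p E" "y \<in> C" by blast
    then show "y \<in> {p C}"
      using pairwise_disjnt_eqI[OF disj C(1), of E y] p[of E] by simp
  qed
  ultimately show False using finite_subset by blast
qed

text \<open>Points selected from distinct members form a sequence without convergent subsequence: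
  the member containing a limit would contain almost all terms of the subsequence.\<close>

lemma sequentially_pracompact_finite_open_partition:
  assumes sp: "sequentially_pracompact X"
    and op: "\<And>C. C \<in> \<C> \<Longrightarrow> openin X C" and ne: "{} \<notin> \<C>"
    and disj: "pairwise disjnt \<C>"
    and cover: "\<Union>\<C> = topspace X"
  shows "finite \<C>"
proof (rule ccontr)
  assume "infinite \<C>"
  then obtain c :: "nat \<Rightarrow> 'a set" where c: "inj c" "range c \<subseteq> \<C>"
    using infinite_countable_subset by blast
  obtain D where D: "dense_subset X D"
    and conv: "\<And>\<sigma> :: nat \<Rightarrow> 'a. range \<sigma> \<subseteq> D \<Longrightarrow>
           \<exists>r x. strict_mono r \<and> limitin X (\<sigma> \<circ> r) x sequentially"
    using sp unfolding sequentially_pracompact_def by blast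
  obtain p where p: "\<And>C. C \<in> \<C> \<Longrightarrow> p C \<in> C \<inter> D"
    using open_partition_selection[OF D _ ne disj] op by blast
  have "range (p \<circ> c) \<subseteq> D" using p c(2) by auto
  then obtain r x where r: "strict_mono r" and lim: "limitin X (p \<circ> c \<circ> r) x sequentially"
    using conv by blast
  obtain C where C: "C \<in> \<C>" "x \<in> C"
    using limitin_topspace[OF lim] cover by blast
  then obtain N where N: "\<And>n. n \<ge> N \<Longrightarrow> p (c (r n)) \<in> C"
    using lim op unfolding limitin_sequentially comp_def by blast
  have "c (r n) = C" if "n \<ge> N" for n
  proof -
    have "c (r n) \<in> \<C>" using c(2) by blast
    then show ?thesis
      using pairwise_disjnt_eqI[OF disj _ C(1)] p N[OF that] by blast
  qed
  \<comment> \<open>Two consecutive late terms already suffice: they come from the same member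
    although \<open>c\<close> and \<open>r\<close> are both injective.\<close>
  then have "c (r N) = c (r (Suc N))" by simp
  then have "r N = r (Suc N)" using c(1) by (simp add: inj_eq)
  then show False using r by (simp add: strict_mono_eq)
qed

section \<open>Finitely many least neighbourhoods with dense union\<close>

context
  fixes X :: "'a topology" and F :: "'a set" and M :: "'a \<Rightarrow> 'a set"
  assumes fin: "finite F" and F: "F \<subseteq> topspace X"
    and least: "\<And>x U. x \<in> F \<Longrightarrow> openin X U \<Longrightarrow> x \<in> U \<Longrightarrow> M x \<subseteq> U"
    and dense: "dense_subset X (\<Union>x\<in>F. M x)"
begin

text \<open>Here \<open>M x\<close> plays the role of \<open>x + S\<close>. A nonempty open set
  meets some \<open>M x\<close> with \<open>x\<close> in \<open>F\<close>, hence every neighbourhood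
  of that \<open>x\<close>. Choosing for each of the finitely many \<open>x\<close> a neighbourhood
  that meets only finitely many members bounds the whole family.\<close>

lemma feebly_compact_if_dense_finite_Union:
  "feebly_compact X"
  unfolding feebly_compact_def
proof (intro allI impI, elim conjE)
  fix \<U> assume op: "\<forall>U\<in>\<U>. openin X U" and lf: "locally_finite_in X \<U>"
  have "\<forall>x\<in>F. \<exists>V. openin X V \<and> x \<in> V \<and> finite {U \<in> \<U>. U \<inter> V \<noteq> {}}"
    using lf F unfolding locally_finite_in_def by blast
  then obtain V where V: "\<And>x. x \<in> F \<Longrightarrow> openin X (V x) \<and> x \<in> V x"
    and finV: "\<And>x. x \<in> F \<Longrightarrow> finite {U \<in> \<U>. U \<inter> V x \<noteq> {}}"
    by metis
  \<comment> \<open>The empty set is added by hand, since it is open but meets no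
    \<open>V x\<close>.\<close>
  have "\<U> \<subseteq> insert {} (\<Union>x\<in>F. {U \<in> \<U>. U \<inter> V x \<noteq> {}})"
  proof
    fix U assume U: "U \<in> \<U>"
    show "U \<in> insert {} (\<Union>x\<in>F. {U \<in> \<U>. U \<inter> V x \<noteq> {}})"
    proof (cases "U = {}")
      case False
      then obtain x where "x \<in> F" "U \<inter> M x \<noteq> {}"
        using dense_subset_meets_open[OF dense, of U] op U by auto
      moreover from this have "M x \<subseteq> V x" using least V by blast
      ultimately show ?thesis using U by blast
    qed simp
  qed
  moreover have "finite (insert {} (\<Union>x\<in>F. {U \<in> \<U>. U \<inter> V x \<noteq> {}}))"
    using fin finV by simp
  ultimately show "finite \<U>" by (rule finite_subset)
qed

text \<open>By the pigeonhole principle an infinite subset of the dense union has infinitely many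
  points in one \<open>M x\<close>, and every open set around \<open>x\<close> contains them
  all.\<close>

lemma countably_pracompact_if_dense_finite_Union:
  "countably_pracompact X"
  unfolding countably_pracompact_def
proof (intro exI[of _ "\<Union>x\<in>F. M x"] conjI dense allI impI, elim conjE)
  fix B assume B: "B \<subseteq> (\<Union>x\<in>F. M x)" "infinite B"
  then have "B = (\<Union>x\<in>F. M x \<inter> B)" by blast
  then obtain x where x: "x \<in> F" "infinite (M x \<inter> B)"
    using B(2) fin by (metis finite_UN_I)
  have "infinite (U \<inter> B)" if "openin X U" "x \<in> U" for U
  proof -
    have "M x \<inter> B \<subseteq> U \<inter> B" using least x(1) that by blast
    then show ?thesis using x(2) finite_subset by blast
  qed
  then show "\<exists>x. accumulation_point X B x"
    unfolding accumulation_point_def using x(1) F by blast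
qed

lemma sequentially_pracompact_if_dense_finite_Union:
  "sequentially_pracompact X"
  unfolding sequentially_pracompact_def
proof (intro exI[of _ "\<Union>x\<in>F. M x"] conjI dense allI impI)
  fix \<sigma> :: "nat \<Rightarrow> 'a" assume \<sigma>: "range \<sigma> \<subseteq> (\<Union>x\<in>F. M x)"
  \<comment> \<open>The pigeonhole principle is applied to indices rather than values, because
    \<open>\<sigma>\<close> may have finite range. The resulting subsequence lies in
    \<open>M x\<close> from its first term on.\<close>
  then have "(\<Union>x\<in>F. {n. \<sigma> n \<in> M x}) = UNIV" by auto
  then obtain x where x: "x \<in> F" "infinite {n. \<sigma> n \<in> M x}"
    using fin by (metis finite_UN_I infinite_UNIV_nat)
  obtain r :: "nat \<Rightarrow> nat" where r: "strict_mono r" "\<And>n. r n \<in> {n. \<sigma> n \<in> M x}"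
    using infinite_enumerate[OF x(2)] by blast
  have "\<sigma> (r n) \<in> U" if "openin X U" "x \<in> U" for U n
    using r(2)[of n] least[OF x(1) that] by blast
  then have "limitin X (\<sigma> \<circ> r) x sequentially"
    unfolding limitin_sequentially using x(1) F by auto
  with r(1) show "\<exists>r x. strict_mono r \<and> limitin X (\<sigma> \<circ> r) x sequentially" by blast
qed

end

section \<open>Cosets of the difference group in the semigroup topology\<close>

context
  fixes G :: "('a, 'b) monoid_scheme" (structure) and S :: "'a set"
  assumes G: "comm_group G" and S: "submonoid S G"
begin

interpretation comm_group G by (rule G)
interpretation S: submonoid S G by (rule S)
interpretation H: subgroup "difference_set G S" G
  by (rule subgroup_difference_set[OF G S])

text \<open>Since \<open>S\<close> is contained in the subgroup \<open>S - S\<close>, translating by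
  an element of \<open>S\<close> does not leave a coset.\<close>

lemma openin_rcoset_difference_set:
  assumes "C \<in> rcosets (difference_set G S)"
  shows "openin (semigroup_topology G S) C"
proof -
  have "S \<subseteq> difference_set G S"
  proof
    fix s assume s: "s \<in> S"
    then have "s = s \<otimes> inv \<one>" using S.subset by auto
    then show "s \<in> difference_set G S"
      unfolding difference_set_def using s S.one_closed by blast
  qed
  then have closed: "h \<otimes> s \<in> difference_set G S" if "h \<in> difference_set G S" "s \<in> S" for h s
    using that H.m_closed by blast
  obtain a where a: "a \<in> carrier G" "C = difference_set G S #> a"
    using assms unfolding RCOSETS_def by blast
  have "c \<otimes> s \<in> C" if "c \<in> C" and s: "s \<in> S" for c s
  proof -
    obtain h where h: "h \<in> difference_set G S" "c = h \<otimes> a"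
      using \<open>c \<in> C\<close> a(2) unfolding r_coset_def by blast
    then have "c \<otimes> s = h \<otimes> s \<otimes> a"
      using a(1) s S.subset H.subset by (simp add: m_ac subset_iff)
    then show ?thesis
      unfolding a(2) r_coset_def using closed[OF h(1) s] by blast
  qed
  moreover have "C \<subseteq> carrier G"
    using r_coset_subset_G[OF H.subset a(1)] a(2) by simp
  ultimately show ?thesis
    unfolding openin_semigroup_topology_iff[OF G S] l_coset_def by blast
qed

lemma l_coset_subset_of_openin:
  assumes "openin (semigroup_topology G S) U" "x \<in> U"
  shows "x <# S \<subseteq> U"
  using assms unfolding openin_semigroup_topology_iff[OF G S] by blast

text \<open>If \<open>x\<close> represents the coset of \<open>u\<close>, then
  \<open>u = s - t + x\<close> with \<open>s\<close> and \<open>t\<close> in \<open>S\<close>. So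
  \<open>u + t = x + s\<close> is a common point of \<open>u + S\<close> and \<open>x + S\<close>,
  and an open set containing \<open>u\<close> contains it.\<close>

lemma dense_l_cosets_of_representatives:
  assumes F: "F \<subseteq> carrier G"
    and rep: "rcosets (difference_set G S) \<subseteq> (\<lambda>x. difference_set G S #> x) ` F"
  shows "dense_subset (semigroup_topology G S) (\<Union>x\<in>F. x <# S)"
proof -
  have sub: "(\<Union>x\<in>F. x <# S) \<subseteq> carrier G"
    using F S.subset unfolding l_coset_def by auto
  have "(\<Union>x\<in>F. x <# S) \<inter> U \<noteq> {}"
    if U: "openin (semigroup_topology G S) U" "U \<noteq> {}" for U
  proof -
    obtain u where u: "u \<in> U" "u \<in> carrier G"
      using U openin_semigroup_topology_iff[OF G S] by blast
    have "difference_set G S #> u \<in> rcosets (difference_set G S)"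
      using u(2) H.subset by (simp add: rcosetsI)
    then obtain x where x: "x \<in> F" "difference_set G S #> u = difference_set G S #> x"
      using rep by blast
    then have "u \<in> difference_set G S #> x"
      using rcos_self[OF u(2) H.subgroup_axioms] by simp
    then obtain s t where st: "s \<in> S" "t \<in> S" "u = s \<otimes> inv t \<otimes> x"
      unfolding r_coset_def difference_set_def by blast
    have car: "s \<in> carrier G" "t \<in> carrier G" "x \<in> carrier G"
      using st x F S.subset by auto
    \<comment> \<open>Reordering with \<open>m_ac\<close> leaves \<open>x\<close> between
      \<open>t\<close> and its inverse; this equation supplies the missing cancellation.\<close>
    have "t \<otimes> (x \<otimes> inv t) = x"
      using car by (simp add: m_lcomm[of t x])
    then have eq: "u \<otimes> t = x \<otimes> s"
      using car st(3) by (simp add: m_ac)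
    have "u \<otimes> t \<in> U"
      using l_coset_subset_of_openin[OF U(1) u(1)] st(2) unfolding l_coset_def by blast
    moreover have "u \<otimes> t \<in> (\<Union>x\<in>F. x <# S)"
      unfolding eq l_coset_def using x(1) st(1) by blast
    ultimately show ?thesis by blast
  qed
  then show ?thesis
    unfolding dense_subset_def dense_intersects_open
    using sub by (simp add: topspace_semigroup_topology[OF G S])
qed

lemma finite_index_of_pracompact:
  assumes "feebly_compact (semigroup_topology G S) \<or>
    countably_pracompact (semigroup_topology G S) \<or>
    sequentially_pracompact (semigroup_topology G S)"
  shows "has_finite_index G (difference_set G S)"
proof -
  let ?\<C> = "rcosets (difference_set G S)"
  have ne: "{} \<notin> ?\<C>"
    using H.rcosets_non_empty by blast
  have disj: "pairwise disjnt ?\<C>"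
    using rcos_disjoint[OF H.subgroup_axioms] by (simp add: pairwise_def disjnt_def)
  have cover: "\<Union>?\<C> = topspace (semigroup_topology G S)"
    using rcosets_part_G[OF H.subgroup_axioms] topspace_semigroup_topology[OF G S] by simp
  note finite_partition =
    feebly_compact_finite_open_partition[OF _ openin_rcoset_difference_set disj cover]
    countably_pracompact_finite_open_partition[OF _ openin_rcoset_difference_set ne disj cover]
    sequentially_pracompact_finite_open_partition[OF _ openin_rcoset_difference_set ne disj cover]
  \<comment> \<open>The three facts have the same conclusion; backtracking over
    \<open>assumption\<close> selects the one whose compactness premise is the disjunct at
    hand.\<close>
  from assms have "finite ?\<C>"
    by (elim disjE) (rule finite_partition; assumption)+
  then show ?thesis
    unfolding has_finite_index_def using H.subgroup_axioms by blast
qed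

lemma pracompact_of_finite_index:
  assumes "has_finite_index G (difference_set G S)"
  shows "feebly_compact (semigroup_topology G S)"
    and "countably_pracompact (semigroup_topology G S)"
    and "sequentially_pracompact (semigroup_topology G S)"
proof -
  have "rcosets (difference_set G S) = (\<lambda>x. difference_set G S #> x) ` carrier G"
    unfolding RCOSETS_def by blast
  moreover have "finite (rcosets (difference_set G S))"
    using assms unfolding has_finite_index_def by blast
  \<comment> \<open>The cosets are the image of \<open>carrier G\<close> under
    \<open>x \<mapsto> H + x\<close>, so a finite set of cosets is already the image of a finite set
    of representatives.\<close>
  ultimately obtain F where F: "F \<subseteq> carrier G" "finite F"
    and rep: "rcosets (difference_set G S) = (\<lambda>x. difference_set G S #> x) ` F"
    by (metis finite_subset_image subset_refl)
  have top: "F \<subseteq> topspace (semigroup_topology G S)"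
    using F(1) topspace_semigroup_topology[OF G S] by simp
  note dense = dense_l_cosets_of_representatives[OF F(1) equalityD1[OF rep]]
  show "feebly_compact (semigroup_topology G S)"
    by (rule feebly_compact_if_dense_finite_Union[OF F(2) top l_coset_subset_of_openin dense])
  show "countably_pracompact (semigroup_topology G S)"
    by (rule countably_pracompact_if_dense_finite_Union[OF F(2) top l_coset_subset_of_openin dense])
  show "sequentially_pracompact (semigroup_topology G S)"
    by (rule sequentially_pracompact_if_dense_finite_Union[OF F(2) top l_coset_subset_of_openin dense])
qed

end

theorem proposition5p7:
  fixes G :: "('a, 'b) monoid_scheme" and S :: "'a set"
  assumes "comm_group G" and "submonoid S G"
  shows "(feebly_compact (semigroup_topology G S) \<longleftrightarrow>
            countably_pracompact (semigroup_topology G S)) \<and>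
         (countably_pracompact (semigroup_topology G S) \<longleftrightarrow>
            sequentially_pracompact (semigroup_topology G S)) \<and>
         (sequentially_pracompact (semigroup_topology G S) \<longleftrightarrow>
            has_finite_index G (difference_set G S))"
  using finite_index_of_pracompact[OF assms] pracompact_of_finite_index[OF assms] by blast

end
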